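(* Let $(G,p)$ be a generic framework on the unit cylinder $\mathcal{Y}$. Then $(G,p)$ is VR-minimally rigid if and only if $G$ is connected and contains exactly one cycle.
   Context: All graphs finite and simple. Let $\mathcal{Y}=\{(x,y,z):x^2+y^2=1\}$; a framework $(G,p)$ on $\mathcal{Y}$ with $V=\{v_1,\dots,v_n\}$ is a map $p:V\to\mathcal{Y}$, generic if its coordinates generate a field of transcendence degree $2n$ over $\mathbb{Q}$. Write $p(v_i)=(x_i,y_i,z_i)$ (for generic $p$, $z_1\neq0$). The VR-rigidity matrix $R^{\mathrm{ver}}_{\mathrm{cyl}}(G,p)$ has $3|V|$ columns (triples indexed by $V$) and $|E|+2|V|-1$ rows: for each edge $v_iv_j$ a row with $p(v_i)-p(v_j)$ in the columns of $v_i$, $p(v_j)-p(v_i)$ in the columns of $v_j$, zeros elsewhere; for each $v_i$ with $i\ne1$ a row with $(0,0,-z_i)$ in the columns of $v_1$, $(0,0,z_1)$ in the columns of $v_i$, zeros elsewhere; for each $v_i\in V$ a row with $(x_i,y_i,0)$ in the columns of $v_i$, zeros elsewhere. (These are the linearisations of the constraints fixing edge lengths, keeping $z_i/z_1$ constant, and keeping each vertex on $\mathcal{Y}$.) $(G,p)$ is VR-(infinitesimally) rigid if $\operatorname{rank}R^{\mathrm{ver}}_{\mathrm{cyl}}(G,p)=3|V|-1$, and VR-minimally rigid if it is VR-rigid and $(G-e,p)$ is not VR-rigid for every edge $e$ of $G$. *)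

theory Defs
  imports "HOL-Analysis.Analysis" "HOL-Library.Poly_Mapping" "HOL-Library.Extended_Nat"
begin

text \<open>
  The vertex set of a graph is the whole of a finite type \<open>'v\<close>, so a graph is given by its
  edge set and deleting an edge keeps all vertices.
\<close>

definition simple_graph :: "'v set set \<Rightarrow> bool" where
  "simple_graph E \<longleftrightarrow> (\<forall>e\<in>E. card e = 2)"

definition connected_graph :: "'v set set \<Rightarrow> bool" where
  "connected_graph E \<longleftrightarrow> (\<forall>u v. (u, v) \<in> {(a, b). {a, b} \<in> E}\<^sup>*)"

text \<open>
  A cycle is a subgraph, not a closed walk with a starting point and a direction; as it has no
  isolated vertices, it is represented by its edge set.
\<close>

definition is_cycle :: "'v set set \<Rightarrow> bool" where
  "is_cycle C \<longleftrightarrow> (\<exists>xs. distinct xs \<and> length xs \<ge> 3 \<and>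
     C = {{xs ! i, xs ! (Suc i mod length xs)} | i. i < length xs})"

definition has_exactly_one_cycle :: "'v set set \<Rightarrow> bool" where
  "has_exactly_one_cycle E \<longleftrightarrow> (\<exists>!C. C \<subseteq> E \<and> is_cycle C)"

text \<open>
  A polynomial over the rationals whose variables are named by real numbers, to be evaluated by
  substituting for each variable the number that names it.  Thus the members of \<open>S\<close> are
  algebraically independent iff no nonzero polynomial in the variables \<open>S\<close> evaluates to 0.
\<close>

definition eval_self :: "((real \<Rightarrow>\<^sub>0 nat) \<Rightarrow>\<^sub>0 rat) \<Rightarrow> real" where
  "eval_self P = (\<Sum>m\<in>Poly_Mapping.keys P. of_rat (Poly_Mapping.lookup P m) *
     (\<Prod>x\<in>Poly_Mapping.keys m. x ^ Poly_Mapping.lookup m x))"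

definition alg_independent :: "real set \<Rightarrow> bool" where
  "alg_independent S \<longleftrightarrow>
     (\<forall>P. (\<forall>m\<in>Poly_Mapping.keys P. Poly_Mapping.keys m \<subseteq> S) \<longrightarrow> eval_self P = 0 \<longrightarrow> P = 0)"

definition real_subfield :: "real set \<Rightarrow> bool" where
  "real_subfield K \<longleftrightarrow> 1 \<in> K \<and>
     (\<forall>x\<in>K. \<forall>y\<in>K. x - y \<in> K \<and> x * y \<in> K) \<and> (\<forall>x\<in>K. inverse x \<in> K)"

text \<open>
  Every subfield contains the rationals, so this is the field generated by \<open>S\<close> over them.
\<close>

definition generated_subfield :: "real set \<Rightarrow> real set" where
  "generated_subfield S = real_subfield hull S"

definition transcendence_degree :: "real set \<Rightarrow> enat" where
  "transcendence_degree K =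
     (SUP B\<in>{B. B \<subseteq> K \<and> finite B \<and> alg_independent B}. enat (card B))"

definition unit_cylinder :: "(real ^ 3) set" where
  "unit_cylinder = {q. (q $ 1)\<^sup>2 + (q $ 2)\<^sup>2 = 1}"

definition generic :: "('v::finite \<Rightarrow> real ^ 3) \<Rightarrow> bool" where
  "generic p \<longleftrightarrow>
     transcendence_degree (generated_subfield {p v $ k | v k. True}) = enat (2 * CARD('v))"

text \<open>
  The rows of the VR-rigidity matrix, where \<open>v1\<close> is the vertex whose height is the reference for
  all others.  The columns are grouped into triples indexed by the vertices, so a row lies in
  \<^typ>\<open>real ^ 3 ^ 'v\<close>, and \<open>axis v t\<close> is the row with \<open>t\<close> in the columns of \<open>v\<close> and zeros elsewhere.
  The edge row is symmetric in the two ends of the edge.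
\<close>

definition vr_matrix_rows ::
  "'v::finite \<Rightarrow> 'v set set \<Rightarrow> ('v \<Rightarrow> real ^ 3) \<Rightarrow> (real ^ 3 ^ 'v) set" where
  "vr_matrix_rows v1 E p =
     {axis u (p u - p v) + axis v (p v - p u) | u v. {u, v} \<in> E} \<union>
     {axis v1 (vector [0, 0, - (p v $ 3)]) + axis v (vector [0, 0, p v1 $ 3]) | v. v \<noteq> v1} \<union>
     {axis v (vector [p v $ 1, p v $ 2, 0]) | v. True}"

text \<open>
  The (row) rank of a matrix is the dimension of the span of its set of rows, as in
  \<open>row_rank_def\<close>.
\<close>

definition vr_matrix_rank :: "'v::finite \<Rightarrow> 'v set set \<Rightarrow> ('v \<Rightarrow> real ^ 3) \<Rightarrow> nat" where
  "vr_matrix_rank v1 E p = dim (vr_matrix_rows v1 E p)"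

definition vr_rigid :: "'v::finite \<Rightarrow> 'v set set \<Rightarrow> ('v \<Rightarrow> real ^ 3) \<Rightarrow> bool" where
  "vr_rigid v1 E p \<longleftrightarrow> vr_matrix_rank v1 E p = 3 * CARD('v) - 1"

definition vr_minimally_rigid :: "'v::finite \<Rightarrow> 'v set set \<Rightarrow> ('v \<Rightarrow> real ^ 3) \<Rightarrow> bool" where
  "vr_minimally_rigid v1 E p \<longleftrightarrow>
     vr_rigid v1 E p \<and> (\<forall>e\<in>E. \<not> vr_rigid v1 (E - {e}) p)"

end

theory Submission
  imports Defs "HOL-Computational_Algebra.Polynomial"
begin

text \<open>
  An infinitesimal motion rotates the vertex \<open>v\<close> with an angular speed \<open>w v\<close> and moves it vertically
  with a speed proportional to its height, with a common factor \<open>- c\<close>. The edge \<open>uv\<close> imposes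
  \<open>w u - w v = c * a u v\<close> with \<open>a u v = (z\<^sub>u - z\<^sub>v)\<^sup>2 / sin (\<theta>\<^sub>u - \<theta>\<^sub>v)\<close>, which is antisymmetric in \<open>u\<close> and
  \<open>v\<close>. So the framework is rigid iff the graph is connected and \<open>a\<close> is not the difference of a
  potential, that is, iff moreover \<open>a\<close> has a nonzero sum around some cycle. For generic \<open>p\<close> the sum
  around every cycle is nonzero, so rigid means connected with at least one cycle. Deleting an edge
  of a cycle keeps the graph connected, so minimality leaves no second cycle.

  Genericity is used through derivations of the reals: for generic \<open>p\<close> every tangent vector of the
  product of cylinders at \<open>p\<close> is the vector of derivatives of the coordinates for some derivation
  \<open>\<real> \<rightarrow> \<real>\<close>. An algebraic relation between the coordinates can therefore be differentiated in any
  tangent direction.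
\<close>

section \<open>Extension of derivations\<close>

text \<open>These are the numbers s + e \<epsilon> with \<epsilon>^2 = 0. The \<epsilon>-part of a
  product follows the Leibniz rule, so a map \<open>D\<close> is a derivation when x \<mapsto>
  \<open>Dual x (D x)\<close> respects sums and products.\<close>

datatype dual = Dual (std: real) (eps: real)

instantiation dual :: comm_ring_1
begin

definition "0 = Dual 0 0"
definition "1 = Dual 1 0"
definition "a + b = Dual (std a + std b) (eps a + eps b)"
definition "a - b = Dual (std a - std b) (eps a - eps b)"
definition "- a = Dual (- std a) (- eps a)"
definition "a * b = Dual (std a * std b) (std a * eps b + eps a * std b)"

instance
  by intro_classes
    (auto simp: zero_dual_def one_dual_def plus_dual_def minus_dual_def uminus_dual_def
      times_dual_def algebra_simps)

end

lemma dual_sel [simp]: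
  "std 0 = 0" "eps 0 = 0" "std 1 = 1" "eps 1 = 0"
  "std (a + b) = std a + std b" "eps (a + b) = eps a + eps b"
  "std (a - b) = std a - std b" "eps (a - b) = eps a - eps b"
  "std (- a) = - std a" "eps (- a) = - eps a"
  "std (a * b) = std a * std b" "eps (a * b) = std a * eps b + eps a * std b"
  by (simp_all add: zero_dual_def one_dual_def plus_dual_def minus_dual_def uminus_dual_def
      times_dual_def)

lemma dual_eq_iff: "a = b \<longleftrightarrow> std a = std b \<and> eps a = eps b"
  by (cases a; cases b) simp

lemma std_sum: "std (sum f A) = (\<Sum>x\<in>A. std (f x))"
  by (induction A rule: infinite_finite_induct) simp_all

lemma std_prod: "std (prod f A) = (\<Prod>x\<in>A. std (f x))"
  by (induction A rule: infinite_finite_induct) simp_all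

lemma std_power: "std (a ^ n) = std a ^ n"
  by (induction n) simp_all

lemma std_of_nat: "std (of_nat n) = of_nat n"
  by (induction n) simp_all

definition dual_inverse :: "dual \<Rightarrow> dual" where
  "dual_inverse a = Dual (inverse (std a)) (- eps a / (std a)\<^sup>2)"

lemma dual_inverse_right: "std a \<noteq> 0 \<Longrightarrow> a * dual_inverse a = 1"
  by (simp add: dual_inverse_def dual_eq_iff field_simps power2_eq_square)

text \<open>
  A derivation defined on a subring \<open>R\<close> of the reals with values in the reals amounts to a subring
  of the dual numbers that is the graph of a function on \<open>R\<close>.
\<close>

definition derivation_graph :: "dual set \<Rightarrow> bool" where
  "derivation_graph G \<longleftrightarrow> 1 \<in> G \<and> (\<forall>a\<in>G. \<forall>b\<in>G. a - b \<in> G \<and> a * b \<in> G) \<and>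
     (\<forall>a\<in>G. std a = 0 \<longrightarrow> a = 0)"

lemma derivation_graphD:
  assumes "derivation_graph G"
  shows "1 \<in> G" "0 \<in> G"
    "\<And>a b. a \<in> G \<Longrightarrow> b \<in> G \<Longrightarrow> a - b \<in> G"
    "\<And>a b. a \<in> G \<Longrightarrow> b \<in> G \<Longrightarrow> a + b \<in> G"
    "\<And>a b. a \<in> G \<Longrightarrow> b \<in> G \<Longrightarrow> a * b \<in> G"
    "\<And>a. a \<in> G \<Longrightarrow> std a = 0 \<Longrightarrow> a = 0"
    "of_nat n \<in> G"
    "\<And>f A. (\<And>x. x \<in> A \<Longrightarrow> f x \<in> G) \<Longrightarrow> sum f A \<in> G"
proof -
  show one: "1 \<in> G"
    and diff: "\<And>a b. a \<in> G \<Longrightarrow> b \<in> G \<Longrightarrow> a - b \<in> G"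
    and "\<And>a b. a \<in> G \<Longrightarrow> b \<in> G \<Longrightarrow> a * b \<in> G"
    and "\<And>a. a \<in> G \<Longrightarrow> std a = 0 \<Longrightarrow> a = 0"
    using assms by (auto simp: derivation_graph_def)
  show zero: "0 \<in> G"
    using diff[OF one one] by simp
  show add: "a + b \<in> G" if "a \<in> G" "b \<in> G" for a b
    using diff[OF \<open>a \<in> G\<close> diff[OF zero \<open>b \<in> G\<close>]] by simp
  show "of_nat n \<in> G"
    by (induction n) (auto intro: zero one add)
  show "sum f A \<in> G" if "\<And>x. x \<in> A \<Longrightarrow> f x \<in> G" for f and A :: "'b set"
    using that by (induction A rule: infinite_finite_induct) (auto intro: zero add)
qed

text \<open>This is the quotient rule. A fraction with standard part 0 has a numerator with standard
  part 0, and that numerator is 0 because \<open>G\<close> is a graph.\<close>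

lemma derivation_graph_fractions:
  assumes G: "derivation_graph G"
  defines "H \<equiv> {a * dual_inverse b | a b. a \<in> G \<and> b \<in> G \<and> std b \<noteq> 0}"
  shows "derivation_graph H" "G \<subseteq> H"
proof -
  have inv1: "dual_inverse 1 = 1"
    by (simp add: dual_inverse_def dual_eq_iff)
  show "G \<subseteq> H"
  proof
    fix a assume "a \<in> G"
    moreover have "a = a * dual_inverse 1"
      by (simp add: inv1)
    moreover have "std 1 \<noteq> 0" by simp
    ultimately show "a \<in> H"
      unfolding H_def using derivation_graphD(1)[OF G] by blast
  qed
  show "derivation_graph H"
    unfolding derivation_graph_def
  proof (intro conjI ballI impI)
    show "1 \<in> H"
      using \<open>G \<subseteq> H\<close> derivation_graphD(1)[OF G] by blast
  next
    fix x y assume "x \<in> H" "y \<in> H"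
    then obtain a b c d where ab: "a \<in> G" "b \<in> G" "std b \<noteq> 0" "x = a * dual_inverse b"
      and cd: "c \<in> G" "d \<in> G" "std d \<noteq> 0" "y = c * dual_inverse d"
      unfolding H_def by blast
    have inv_mult: "dual_inverse (b * d) = dual_inverse b * dual_inverse d"
      using ab cd by (simp add: dual_inverse_def dual_eq_iff field_simps power2_eq_square)
    have "(a * d - c * b) * dual_inverse (b * d) =
        a * dual_inverse b * (d * dual_inverse d) - c * dual_inverse d * (b * dual_inverse b)"
      unfolding inv_mult by (simp add: algebra_simps)
    then have "x - y = (a * d - c * b) * dual_inverse (b * d)"
      using ab cd by (simp add: dual_inverse_right)
    moreover have "x * y = (a * c) * dual_inverse (b * d)"
      using ab cd by (simp add: inv_mult mult_ac)
    moreover have "std (b * d) \<noteq> 0"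
      using ab cd by simp
    ultimately show "x - y \<in> H" "x * y \<in> H"
      unfolding H_def using ab cd derivation_graphD(3,5)[OF G] by blast+
  next
    fix x assume "x \<in> H" "std x = 0"
    then obtain a b where a: "a \<in> G" and "std b \<noteq> 0" and x: "x = a * dual_inverse b"
      unfolding H_def by blast
    then have "std a = 0"
      using \<open>std x = 0\<close> by (simp add: dual_inverse_def)
    then have "a = 0"
      using derivation_graphD(6)[OF G a] by blast
    then show "x = 0" using x by simp
  qed
qed

lemma std_poly: "std (poly P x) = poly (map_poly std P) (std x)"
  by (induction P) (simp_all add: map_poly_pCons)

text \<open>First-order Taylor expansion in the \<epsilon>-part of the argument. The
  \<epsilon>-parts of the coefficients contribute only to the term free of \<open>s\<close>, so the
  value can be made to vanish by solving a linear equation for \<open>s\<close>.\<close>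

lemma eps_poly:
  "eps (poly P (Dual t s)) = eps (poly P (Dual t 0)) + s * poly (pderiv (map_poly std P)) t"
  by (induction P) (simp_all add: map_poly_pCons pderiv_pCons std_poly algebra_simps)

text \<open>The set \<open>H\<close> is the ring obtained from \<open>G\<close> by adjoining
  \<open>T\<close>, and \<open>ext\<close> is exactly the condition that \<open>H\<close> is still
  the graph of a function.\<close>

lemma derivation_graph_poly:
  assumes G: "derivation_graph G"
    and ext: "\<And>P. range (coeff P) \<subseteq> G \<Longrightarrow> std (poly P T) = 0 \<Longrightarrow> poly P T = 0"
  defines "H \<equiv> {poly P T | P. range (coeff P) \<subseteq> G}"
  shows "derivation_graph H" "G \<subseteq> H" "T \<in> H"
proof -
  note GD = derivation_graphD[OF G]
  have const: "range (coeff [:a:]) \<subseteq> G" if "a \<in> G" for a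
    using that GD(2) by (auto simp: coeff_pCons split: nat.splits)
  show sub: "G \<subseteq> H"
  proof
    fix a assume "a \<in> G"
    then have "range (coeff [:a:]) \<subseteq> G" by (rule const)
    moreover have "a = poly [:a:] T" by simp
    ultimately show "a \<in> H" unfolding H_def by blast
  qed
  have "range (coeff [:0, 1:]) \<subseteq> G"
    using GD(1,2) by (auto simp: coeff_pCons split: nat.splits)
  moreover have "T = poly [:0, 1:] T" by simp
  ultimately show "T \<in> H" unfolding H_def by blast
  show "derivation_graph H"
    unfolding derivation_graph_def
  proof (intro conjI ballI impI)
    show "1 \<in> H" using sub GD(1) by blast
  next
    fix x y assume "x \<in> H" "y \<in> H"
    then obtain P Q where P: "range (coeff P) \<subseteq> G" "x = poly P T"
      and Q: "range (coeff Q) \<subseteq> G" "y = poly Q T"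
      unfolding H_def by blast
    have "range (coeff (P - Q)) \<subseteq> G"
      using P(1) Q(1) GD(3) by (auto simp: image_subset_iff)
    moreover have "x - y = poly (P - Q) T"
      using P Q by simp
    ultimately show "x - y \<in> H" unfolding H_def by blast
    have "range (coeff (P * Q)) \<subseteq> G"
      using P(1) Q(1) by (auto simp: coeff_mult image_subset_iff intro!: GD(8) GD(5))
    moreover have "x * y = poly (P * Q) T"
      using P Q by simp
    ultimately show "x * y \<in> H" unfolding H_def by blast
  next
    fix x assume "x \<in> H" "std x = 0"
    then show "x = 0" using ext unfolding H_def by blast
  qed
qed

text \<open>
  The derivative of \<open>t\<close> is arbitrary if \<open>t\<close> is transcendental over the domain, and otherwise
  determined by the minimal polynomial.
\<close>

lemma derivation_extension_step:
  assumes G: "derivation_graph G"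
    and inv: "\<And>a. a \<in> G \<Longrightarrow> std a \<noteq> 0 \<Longrightarrow> dual_inverse a \<in> G"
  shows "\<exists>s. \<forall>P. range (coeff P) \<subseteq> G \<longrightarrow> std (poly P (Dual t s)) = 0 \<longrightarrow> poly P (Dual t s) = 0"
proof (cases "\<exists>P. range (coeff P) \<subseteq> G \<and> P \<noteq> 0 \<and> std (poly P (Dual t 0)) = 0")
  case False
  \<comment> \<open>Here \<open>t\<close> is transcendental: only \<open>P = 0\<close> meets the
    premises, so the witness \<open>s = 0\<close> works.\<close>
  then have "\<forall>P. range (coeff P) \<subseteq> G \<longrightarrow> std (poly P (Dual t 0)) = 0 \<longrightarrow> poly P (Dual t 0) = 0"
    by (metis poly_0)
  then show ?thesis by blast
next
  case True
  note GD = derivation_graphD[OF G]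
  define ann where "ann P \<longleftrightarrow> range (coeff P) \<subseteq> G \<and> P \<noteq> 0 \<and> std (poly P (Dual t 0)) = 0" for P
  obtain P where "ann P" and min: "\<And>Q. ann Q \<Longrightarrow> degree P \<le> degree Q"
    using True ex_has_least_nat[of ann _ degree] unfolding ann_def by blast
  then have PG: "coeff P i \<in> G" and "P \<noteq> 0" and Pt: "std (poly P (Dual t 0)) = 0" for i
    unfolding ann_def by auto
  have lc: "std (lead_coeff P) \<noteq> 0"
    using GD(6)[OF PG[of "degree P"]] \<open>P \<noteq> 0\<close> by auto
  have deg: "degree P \<noteq> 0"
  proof
    assume "degree P = 0"
    then obtain c where "P = [:c:]" by (rule degree_eq_zeroE)
    then show False using Pt lc by simp
  qed
  \<comment> \<open>The formal derivative of \<open>P\<close> has coefficients in \<open>G\<close>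
    and smaller degree, and it is nonzero because the characteristic is 0. By minimality of
    \<open>P\<close> it does not annihilate \<open>t\<close>, so \<open>t\<close> is a simple
    root.\<close>
  define P' where "P' = (\<Sum>i<degree P. monom (of_nat (Suc i) * coeff P (Suc i)) i)"
  have coeff_P': "coeff P' i = (if i < degree P then of_nat (Suc i) * coeff P (Suc i) else 0)" for i
    unfolding P'_def by (simp add: coeff_sum if_distrib cong: if_cong)
  have map_P': "map_poly std P' = pderiv (map_poly std P)"
    by (rule poly_eqI) (auto simp: coeff_map_poly coeff_pderiv coeff_P' std_of_nat coeff_eq_0)
  have "range (coeff P') \<subseteq> G"
    using PG by (auto simp: coeff_P' simp del: of_nat_Suc intro!: GD(2) GD(5) GD(7))
  moreover have "P' \<noteq> 0"
  proof
    assume "P' = 0"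
    then have "std (coeff P' (degree P - 1)) = 0" by simp
    then show False
      using deg lc by (simp add: coeff_P' std_of_nat del: of_nat_Suc)
  qed
  moreover have "degree P' < degree P"
    using deg by (intro degree_lessI) (auto simp: coeff_P')
  ultimately have "std (poly P' (Dual t 0)) \<noteq> 0"
    using min[of P'] unfolding ann_def by auto
  then have der: "poly (pderiv (map_poly std P)) t \<noteq> 0"
    by (simp add: std_poly map_P')
  \<comment> \<open>The solution of \<open>eps (poly P (Dual t s)) = 0\<close>, by
    \<open>eps_poly\<close>.\<close>
  define s where "s = - eps (poly P (Dual t 0)) / poly (pderiv (map_poly std P)) t"
  have std_indep: "std (poly Q (Dual t s)) = std (poly Q (Dual t 0))" for Q
    by (simp add: std_poly)
  have root: "poly P (Dual t s) = 0"
    unfolding dual_eq_iff eps_poly[of P t s] std_indep using der Pt by (simp add: s_def)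
  have "poly Q (Dual t s) = 0"
    if "range (coeff Q) \<subseteq> G" "std (poly Q (Dual t s)) = 0" for Q
    using that
  proof (induction "degree Q" arbitrary: Q rule: less_induct)
    case less
    then have QG: "coeff Q i \<in> G" for i by auto
    show ?case
    proof (cases "Q = 0")
      case False
      then have dle: "degree P \<le> degree Q"
        using min[of Q] less.prems unfolding ann_def std_indep by auto
      \<comment> \<open>One step of division by \<open>P\<close>: \<open>R\<close> loses the leading
        term of \<open>Q\<close>, keeps its coefficients in \<open>G\<close> and has the same value
        at \<open>Dual t s\<close>, a root of \<open>P\<close>.\<close>
      define c where "c = lead_coeff Q * dual_inverse (lead_coeff P)"
      have cG: "c \<in> G"
        unfolding c_def by (intro GD(5) QG inv PG lc)
      define R where "R = Q - monom c (degree Q - degree P) * P"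
      have coeff_R: "coeff R i = coeff Q i -
          (if degree Q - degree P \<le> i then c * coeff P (i - (degree Q - degree P)) else 0)" for i
        unfolding R_def by (simp add: coeff_monom_mult)
      have RG: "range (coeff R) \<subseteq> G"
        by (auto simp: coeff_R intro!: GD(2) GD(3) GD(5) QG PG cG)
      have RT: "poly R (Dual t s) = poly Q (Dual t s)"
        by (simp add: R_def root)
      have "coeff R i = 0" if "degree Q \<le> i" for i
      proof (cases "i = degree Q")
        case True
        have "c * lead_coeff P = lead_coeff Q * (lead_coeff P * dual_inverse (lead_coeff P))"
          by (simp add: c_def mult_ac)
        then show ?thesis using True dle lc by (simp add: coeff_R dual_inverse_right)
      next
        case False
        then have "coeff Q i = 0" "coeff P (i - (degree Q - degree P)) = 0"
          using that dle by (intro coeff_eq_0; linarith)+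
        then show ?thesis by (simp add: coeff_R)
      qed
      then have "R = 0 \<or> degree R < degree Q"
        by (metis leading_coeff_0_iff not_le)
      then show ?thesis
        using less.hyps[of R] RG RT less.prems(2) by auto
    qed simp
  qed
  then show ?thesis by blast
qed

definition derivation :: "(real \<Rightarrow> real) \<Rightarrow> bool" where
  "derivation D \<longleftrightarrow> (\<forall>x y. D (x + y) = D x + D y \<and> D (x * y) = x * D y + D x * y)"

text \<open>Zorn's lemma gives a maximal graph \<open>M\<close>. Closure under fractions makes its
  domain a field, the extension step then places every real in the domain, and the ring operations
  of \<open>M\<close> are the sum and product rules for \<open>D\<close>.\<close>

lemma derivation_graph_total:
  assumes G0: "derivation_graph G0"
  shows "\<exists>D. derivation D \<and> (\<forall>a\<in>G0. D (std a) = eps a)"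
proof -
  define A where "A = {G. derivation_graph G \<and> G0 \<subseteq> G}"
  have chain: "\<exists>U\<in>A. \<forall>X\<in>C. X \<subseteq> U" if C: "subset.chain A C" for C
  proof (cases "C = {}")
    case True
    then show ?thesis using G0 unfolding A_def by blast
  next
    case False
    have CA: "\<And>X. X \<in> C \<Longrightarrow> derivation_graph X \<and> G0 \<subseteq> X"
      using C unfolding subset.chain_def A_def by blast
    have lin: "\<exists>X\<in>C. a \<in> X \<and> b \<in> X" if "a \<in> \<Union>C" "b \<in> \<Union>C" for a b
      using that subset.chain_total[OF C] by blast
    have "derivation_graph (\<Union>C)"
      unfolding derivation_graph_def
    proof (intro conjI ballI impI)
      show "1 \<in> \<Union>C" using False CA derivation_graphD(1) by blast
      show "a - b \<in> \<Union>C" "a * b \<in> \<Union>C" if "a \<in> \<Union>C" "b \<in> \<Union>C" for a b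
        using lin[OF that] CA derivation_graphD(3,5) by blast+
      show "a = 0" if "a \<in> \<Union>C" "std a = 0" for a
        using that CA derivation_graphD(6) by blast
    qed
    then have "\<Union>C \<in> A" using False CA unfolding A_def by blast
    then show ?thesis by blast
  qed
  from subset_Zorn[OF this] obtain M where "M \<in> A"
    and max: "\<And>X. X \<in> A \<Longrightarrow> M \<subseteq> X \<Longrightarrow> X = M" by blast
  then have M: "derivation_graph M" and sub: "G0 \<subseteq> M" unfolding A_def by auto
  note MD = derivation_graphD[OF M]
  have inv: "dual_inverse a \<in> M" if "a \<in> M" "std a \<noteq> 0" for a
  proof -
    let ?H = "{a * dual_inverse b | a b. a \<in> M \<and> b \<in> M \<and> std b \<noteq> 0}"
    have "?H = M"
      using max[of ?H] derivation_graph_fractions[OF M] sub unfolding A_def by blast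
    moreover have "1 * dual_inverse a \<in> ?H"
      using that MD(1) by blast
    ultimately show ?thesis by simp
  qed
  have total: "\<exists>s. Dual t s \<in> M" for t
  proof -
    obtain s where s: "\<And>P. range (coeff P) \<subseteq> M \<Longrightarrow> std (poly P (Dual t s)) = 0 \<Longrightarrow>
        poly P (Dual t s) = 0"
      using derivation_extension_step[OF M inv] by blast
    let ?H = "{poly P (Dual t s) | P. range (coeff P) \<subseteq> M}"
    have "?H = M"
      using max[of ?H] derivation_graph_poly(1,2)[OF M s] sub unfolding A_def by blast
    then show ?thesis
      using derivation_graph_poly(3)[OF M s] by blast
  qed
  then obtain D where D: "\<And>t. Dual t (D t) \<in> M" by metis
  \<comment> \<open>Two members of \<open>M\<close> with the same standard part differ by a member
    with standard part 0.\<close>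
  have uniq: "eps a = D (std a)" if "a \<in> M" for a
    using MD(6)[OF MD(3)[OF that D[of "std a"]]] by (simp add: dual_eq_iff)
  have "derivation D"
    unfolding derivation_def
  proof (intro allI conjI)
    fix x y
    show "D (x + y) = D x + D y"
      using uniq[OF MD(4)[OF D[of x] D[of y]]] by simp
    show "D (x * y) = x * D y + D x * y"
      using uniq[OF MD(5)[OF D[of x] D[of y]]] by simp
  qed
  moreover have "\<forall>a\<in>G0. D (std a) = eps a"
    using uniq sub by (simp add: subset_iff)
  ultimately show ?thesis by blast
qed

section \<open>Derivations and genericity\<close>

definition monomial_value :: "(real \<Rightarrow> 'a) \<Rightarrow> (real \<Rightarrow>\<^sub>0 nat) \<Rightarrow> 'a::comm_ring_1" where
  "monomial_value f m = (\<Prod>x\<in>Poly_Mapping.keys m. f x ^ Poly_Mapping.lookup m x)"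

lemma monomial_value_superset:
  assumes "finite A" "Poly_Mapping.keys m \<subseteq> A"
  shows "monomial_value f m = (\<Prod>x\<in>A. f x ^ Poly_Mapping.lookup m x)"
  unfolding monomial_value_def
  by (rule prod.mono_neutral_left) (use assms in \<open>auto simp: in_keys_iff\<close>)

lemma monomial_value_add: "monomial_value f (m + n) = monomial_value f m * monomial_value f n"
proof -
  let ?A = "Poly_Mapping.keys m \<union> Poly_Mapping.keys n"
  have "monomial_value f (m + n) = (\<Prod>x\<in>?A. f x ^ Poly_Mapping.lookup (m + n) x)"
    by (rule monomial_value_superset) (use keys_add[of m n] in auto)
  also have "\<dots> = (\<Prod>x\<in>?A. f x ^ Poly_Mapping.lookup m x) * (\<Prod>x\<in>?A. f x ^ Poly_Mapping.lookup n x)"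
    by (simp add: lookup_add power_add prod.distrib)
  also have "\<dots> = monomial_value f m * monomial_value f n"
    by (simp add: monomial_value_superset[of ?A])
  finally show ?thesis .
qed

text \<open>Each variable x receives the value x + d(x) \<epsilon>. The \<epsilon>-part of the
  result is the derivative of \<open>P\<close> in the direction \<open>d\<close>, obtained without
  partial derivatives.\<close>

definition eval_dual :: "(real \<Rightarrow> real) \<Rightarrow> ((real \<Rightarrow>\<^sub>0 nat) \<Rightarrow>\<^sub>0 rat) \<Rightarrow> dual" where
  "eval_dual d P = (\<Sum>m\<in>Poly_Mapping.keys P.
     Dual (of_rat (Poly_Mapping.lookup P m)) 0 * monomial_value (\<lambda>x. Dual x (d x)) m)"

lemma std_eval_dual: "std (eval_dual d P) = eval_self P"
  by (simp add: eval_dual_def eval_self_def monomial_value_def std_sum std_prod std_power)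

lemma eval_dual_add: "eval_dual d (P + Q) = eval_dual d P + eval_dual d Q"
  unfolding eval_dual_def
  by (rule setsum_keys_plus_distrib) (auto simp: dual_eq_iff of_rat_add algebra_simps)

lemma eval_dual_zero [simp]: "eval_dual d 0 = 0"
  by (simp add: eval_dual_def)

lemma eval_dual_diff: "eval_dual d (P - Q) = eval_dual d P - eval_dual d Q"
  using eval_dual_add[of d "P - Q" Q] by simp

lemma eval_dual_single:
  "eval_dual d (Poly_Mapping.single m c) =
     Dual (of_rat c) 0 * monomial_value (\<lambda>x. Dual x (d x)) m"
  by (auto simp: eval_dual_def dual_eq_iff)

lemma poly_mapping_single_induct:
  fixes P :: "'a \<Rightarrow>\<^sub>0 'b::ab_group_add"
  assumes "Q 0" and step: "\<And>m c P. Q P \<Longrightarrow> Q (Poly_Mapping.single m c + P)"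
  shows "Q P"
proof (induction P rule: update_induct)
  case (update f a b)
  have "Poly_Mapping.update a b f = Poly_Mapping.single a b + f"
    using update(1) by (intro poly_mapping_eqI)
      (auto simp: lookup_add lookup_update lookup_single when_def in_keys_iff)
  then show ?case using step[OF update(3)] by simp
qed (rule assms)

lemma eval_dual_mult: "eval_dual d (P * Q) = eval_dual d P * eval_dual d Q"
proof -
  have single: "eval_dual d (Poly_Mapping.single m c * Q) = eval_dual d (Poly_Mapping.single m c) * eval_dual d Q"
    for m c
  proof (induction Q rule: poly_mapping_single_induct)
    case (2 m' c' Q)
    have "eval_dual d (Poly_Mapping.single m c * Poly_Mapping.single m' c') =
        eval_dual d (Poly_Mapping.single m c) * eval_dual d (Poly_Mapping.single m' c')"
      by (simp add: mult_single eval_dual_single monomial_value_add dual_eq_iff of_rat_mult algebra_simps)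
    then show ?case using 2 by (simp add: distrib_left eval_dual_add)
  qed simp
  show ?thesis
    by (induction P rule: poly_mapping_single_induct) (simp_all add: distrib_right eval_dual_add single)
qed

text \<open>The dual values of the polynomials in the variables \<open>B\<close> form a ring.
  Independence says that such a polynomial with real value 0 is itself 0, so this ring is a
  derivation graph and extends to all reals.\<close>

lemma derivation_on_alg_independent:
  assumes B: "alg_independent B"
  shows "\<exists>D. derivation D \<and> (\<forall>b\<in>B. D b = d b)"
proof -
  define A where "A = {P :: (real \<Rightarrow>\<^sub>0 nat) \<Rightarrow>\<^sub>0 rat. \<forall>m\<in>Poly_Mapping.keys P. Poly_Mapping.keys m \<subseteq> B}"
  have "derivation_graph (eval_dual d ` A)"
    unfolding derivation_graph_def
  proof (intro conjI ballI impI)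
    have "1 \<in> A" by (simp add: A_def)
    moreover have "eval_dual d 1 = 1"
      using eval_dual_single[of d 0 1] by (simp add: monomial_value_def dual_eq_iff)
    ultimately show "1 \<in> eval_dual d ` A" by force
  next
    fix a b assume "a \<in> eval_dual d ` A" "b \<in> eval_dual d ` A"
    then obtain P Q where P: "P \<in> A" "a = eval_dual d P" and Q: "Q \<in> A" "b = eval_dual d Q"
      by blast
    have "P - Q \<in> A"
      using P(1) Q(1) keys_diff[of P Q] unfolding A_def by blast
    then show "a - b \<in> eval_dual d ` A"
      using P Q by (simp flip: eval_dual_diff)
    have "P * Q \<in> A"
      unfolding A_def
    proof (intro CollectI ballI)
      fix m assume "m \<in> Poly_Mapping.keys (P * Q)"
      then obtain k l where "m = k + l" "k \<in> Poly_Mapping.keys P" "l \<in> Poly_Mapping.keys Q"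
        using keys_mult[of P Q] by blast
      then show "Poly_Mapping.keys m \<subseteq> B"
        using P(1) Q(1) keys_add[of k l] unfolding A_def by blast
    qed
    then show "a * b \<in> eval_dual d ` A"
      using P Q by (simp flip: eval_dual_mult)
  next
    fix a assume "a \<in> eval_dual d ` A" "std a = 0"
    then obtain P where P: "P \<in> A" "a = eval_dual d P" "eval_self P = 0"
      by (auto simp: std_eval_dual)
    then have "P = 0"
      using B unfolding alg_independent_def A_def by blast
    then show "a = 0" using P(2) by simp
  qed
  from derivation_graph_total[OF this] obtain D
    where D: "derivation D" "\<And>P. P \<in> A \<Longrightarrow> D (eval_self P) = eps (eval_dual d P)"
    by (auto simp: std_eval_dual)
  have "D b = d b" if "b \<in> B" for b
  proof -
    let ?P = "Poly_Mapping.single (Poly_Mapping.single b 1) 1 :: (real \<Rightarrow>\<^sub>0 nat) \<Rightarrow>\<^sub>0 rat"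
    have "eval_dual d ?P = Dual b (d b)"
      by (simp add: eval_dual_single monomial_value_def dual_eq_iff)
    moreover from this have "eval_self ?P = b"
      using std_eval_dual[of d ?P] by simp
    moreover have "?P \<in> A"
      using that by (simp add: A_def)
    ultimately show ?thesis using D(2)[of ?P] by simp
  qed
  then show ?thesis using D(1) by blast
qed

section \<open>Calculus rules for a derivation of the reals\<close>

context
  fixes D :: "real \<Rightarrow> real"
  assumes D: "derivation D"
begin

lemma derivation_add: "D (x + y) = D x + D y"
  and derivation_mult: "D (x * y) = x * D y + D x * y"
  using D by (auto simp: derivation_def)

lemma derivation_zero: "D 0 = 0"
  using derivation_add[of 0 0] by simp

lemma derivation_one: "D 1 = 0"
  using derivation_mult[of 1 1] by simp

lemma derivation_minus: "D (- x) = - D x"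
  using derivation_add[of x "- x"] derivation_zero by simp

lemma derivation_diff: "D (x - y) = D x - D y"
  using derivation_add[of x "- y"] derivation_minus[of y] by simp

lemma derivation_power2: "D (x\<^sup>2) = 2 * x * D x"
  by (simp add: power2_eq_square derivation_mult)

lemma derivation_inverse: "D (inverse x) = - D x / x\<^sup>2"
proof (cases "x = 0")
  case False
  then have "x * D (inverse x) + D x * inverse x = 0"
    using derivation_mult[of x "inverse x"] derivation_one by simp
  then show ?thesis
    using False by (simp add: field_simps power2_eq_square)
qed (simp add: derivation_zero)

lemma derivation_sum: "D (sum f A) = (\<Sum>x\<in>A. D (f x))"
  by (induction A rule: infinite_finite_induct) (simp_all add: derivation_zero derivation_add)

lemma derivation_divide: "D (x / y) = D x / y - x * D y / y\<^sup>2"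
  by (simp add: divide_inverse[of x y] derivation_mult derivation_inverse)
    (simp add: field_simps)

lemma derivation_zero_subfield: "real_subfield {x. D x = 0}"
  unfolding real_subfield_def
  by (simp add: derivation_one derivation_diff derivation_mult derivation_inverse)

end

text \<open>The zeros of a derivation form a subfield, so they contain the hull of \<open>S\<close>
  as soon as they contain \<open>S\<close>.\<close>

lemma derivation_vanishes_on_generated_subfield:
  assumes "derivation D" "\<And>x. x \<in> S \<Longrightarrow> D x = 0" "y \<in> generated_subfield S"
  shows "D y = 0"
proof -
  have "real_subfield hull S \<subseteq> {x. D x = 0}"
    by (rule hull_minimal) (use assms derivation_zero_subfield[of D] in auto)
  then show ?thesis using assms(3) unfolding generated_subfield_def by blast
qed

lemma derivation_linear_combination:
  assumes "\<And>i. i \<in> I \<Longrightarrow> derivation (D i)"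
  shows "derivation (\<lambda>x. \<Sum>i\<in>I. c i * D i x)"
proof -
  have "c i * D i (x + y) = c i * D i x + c i * D i y"
    "c i * D i (x * y) = x * (c i * D i y) + (c i * D i x) * y" if "i \<in> I" for i x y
    using assms[OF that] by (simp_all add: derivation_def algebra_simps)
  then show ?thesis
    unfolding derivation_def
    by (simp add: sum.distrib sum_distrib_left sum_distrib_right cong: sum.cong)
qed

text \<open>If all finite independent sets had fewer than \<open>n\<close> elements, the supremum
  would be at most \<open>n - 1\<close>, which is below \<open>n\<close> as
  \<open>n > 0\<close>.\<close>

lemma transcendence_degree_attained:
  assumes "transcendence_degree K = enat n" "n > 0"
  shows "\<exists>B \<subseteq> K. finite B \<and> alg_independent B \<and> n \<le> card B"
proof (rule ccontr)
  assume neg: "\<not> ?thesis"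
  have "transcendence_degree K \<le> enat (n - 1)"
    unfolding transcendence_degree_def
  proof (rule SUP_least)
    fix B assume "B \<in> {B. B \<subseteq> K \<and> finite B \<and> alg_independent B}"
    then have "\<not> n \<le> card B" using neg by blast
    then show "enat (card B) \<le> enat (n - 1)" by simp
  qed
  then show False using assms by simp
qed

text \<open>
  The vectors of derivatives of the coordinates form a subspace whose dimension is at least the
  transcendence degree of the coordinates, hence all of the tangent space of the product of
  cylinders at \<open>p\<close>.
\<close>

lemma generic_tangent_derivation:
  fixes p :: "'v::finite \<Rightarrow> real ^ 3" and w t :: "'v \<Rightarrow> real"
  assumes cyl: "\<forall>v. p v \<in> unit_cylinder" and gen: "generic p"
  shows "\<exists>D. derivation D \<and>
    (\<forall>v. D (p v $ 1) = - (p v $ 2) * w v \<and> D (p v $ 2) = p v $ 1 * w v \<and> D (p v $ 3) = t v)"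
proof -
  define S where "S = {p v $ k | v k. True}"
  define vec :: "(real \<Rightarrow> real) \<Rightarrow> real ^ 3 ^ 'v" where "vec D = (\<chi> v k. D (p v $ k))" for D
  define W where "W = vec ` {D. derivation D}"
  define tangent :: "(real ^ 'v) \<times> (real ^ 'v) \<Rightarrow> real ^ 3 ^ 'v" where
    "tangent q = (\<chi> v. vector [- (p v $ 2) * (fst q $ v), p v $ 1 * (fst q $ v), snd q $ v])" for q
  have circle: "(p v $ 1)\<^sup>2 + (p v $ 2)\<^sup>2 = 1" for v
    using cyl by (simp add: unit_cylinder_def)
  have "linear tangent"
    by (rule linearI)
      (auto simp: tangent_def vec_eq_iff forall_3 algebra_simps)
  then have sub_tangent: "subspace (range tangent)"
    by (simp add: linear_subspace_image)
  have "dim (range tangent) \<le> DIM((real ^ 'v) \<times> (real ^ 'v))"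
    using dim_image_le[OF \<open>linear tangent\<close>, of UNIV] by simp
  then have dim_tangent: "dim (range tangent) \<le> 2 * CARD('v)" by simp
  have sub_W: "subspace W"
  proof (rule subspaceI)
    have "derivation (\<lambda>x. 0)" by (simp add: derivation_def)
    moreover have "vec (\<lambda>x. 0) = 0" by (simp add: vec_def vec_eq_iff)
    ultimately show "0 \<in> W" unfolding W_def by force
    show "x + y \<in> W" if "x \<in> W" "y \<in> W" for x y
    proof -
      obtain D D' where "derivation D" "derivation D'" "x = vec D" "y = vec D'"
        using \<open>x \<in> W\<close> \<open>y \<in> W\<close> unfolding W_def by blast
      moreover have "derivation (\<lambda>x. D x + D' x)"
        using calculation by (simp add: derivation_def algebra_simps)
      moreover have "vec (\<lambda>x. D x + D' x) = vec D + vec D'"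
        by (simp add: vec_def vec_eq_iff)
      ultimately show ?thesis unfolding W_def by force
    qed
    show "c *\<^sub>R x \<in> W" if "x \<in> W" for c x
    proof -
      obtain D where "derivation D" "x = vec D"
        using \<open>x \<in> W\<close> unfolding W_def by blast
      moreover have "derivation (\<lambda>x. c * D x)"
        using calculation by (simp add: derivation_def algebra_simps)
      moreover have "vec (\<lambda>x. c * D x) = c *\<^sub>R vec D"
        by (simp add: vec_def vec_eq_iff)
      ultimately show ?thesis unfolding W_def by force
    qed
  qed
  have "W \<subseteq> range tangent"
  proof
    fix x assume "x \<in> W"
    then obtain D where D: "derivation D" "x = vec D" unfolding W_def by blast
    have tan: "p v $ 1 * D (p v $ 1) + p v $ 2 * D (p v $ 2) = 0" for v
    proof -
      have "D ((p v $ 1)\<^sup>2 + (p v $ 2)\<^sup>2) = 0"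
        using circle[of v] derivation_one[OF D(1)] by simp
      then show ?thesis
        by (simp add: derivation_add[OF D(1)] derivation_power2[OF D(1)])
    qed
    \<comment> \<open>The angular speed: the product of the derivative of (x, y) with the unit
      tangent (-y, x). Differentiating the circle equation (\<open>tan\<close>) leaves no radial
      part.\<close>
    define s where "s v = p v $ 1 * D (p v $ 2) - p v $ 2 * D (p v $ 1)" for v
    have "- (p v $ 2) * s v = D (p v $ 1)" "p v $ 1 * s v = D (p v $ 2)" for v
    proof -
      have "- (p v $ 2) * s v = ((p v $ 1)\<^sup>2 + (p v $ 2)\<^sup>2) * D (p v $ 1)
          - p v $ 1 * (p v $ 1 * D (p v $ 1) + p v $ 2 * D (p v $ 2))"
        by (simp add: s_def algebra_simps power2_eq_square)
      then show "- (p v $ 2) * s v = D (p v $ 1)" by (simp add: tan circle)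
      have "p v $ 1 * s v = ((p v $ 1)\<^sup>2 + (p v $ 2)\<^sup>2) * D (p v $ 2)
          - p v $ 2 * (p v $ 1 * D (p v $ 1) + p v $ 2 * D (p v $ 2))"
        by (simp add: s_def algebra_simps power2_eq_square)
      then show "p v $ 1 * s v = D (p v $ 2)" by (simp add: tan circle)
    qed
    then have "x = tangent (\<chi> v. s v, \<chi> v. D (p v $ 3))"
      by (simp add: D(2) vec_def tangent_def vec_eq_iff forall_3)
    then show "x \<in> range tangent" by blast
  qed
  moreover have "2 * CARD('v) \<le> dim W"
  proof -
    have "transcendence_degree (generated_subfield S) = enat (2 * CARD('v))"
      using gen by (simp add: generic_def S_def)
    from transcendence_degree_attained[OF this] obtain B
      where B: "B \<subseteq> generated_subfield S" "finite B" "alg_independent B" "2 * CARD('v) \<le> card B"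
      by auto
    \<comment> \<open>A family of derivations dual to \<open>B\<close>.\<close>
    have "\<forall>b. \<exists>D. derivation D \<and> (\<forall>b'\<in>B. D b' = (if b' = b then 1 else 0))"
      by (intro allI derivation_on_alg_independent B(3))
    then obtain D where D: "\<And>b. derivation (D b)"
      and D_dual: "\<And>b b'. b' \<in> B \<Longrightarrow> D b b' = (if b' = b then 1 else 0)"
      by metis
    \<comment> \<open>A linear relation between the vectors gives a derivation \<open>F\<close> that
      kills all coordinates, hence the field they generate and with it \<open>B\<close>. But the
      value of \<open>F\<close> at \<open>b\<close> is \<open>c b\<close>.\<close>
    have lin_indep: "c b = 0" if "(\<Sum>b\<in>B. c b *\<^sub>R vec (D b)) = 0" "b \<in> B" for c b
    proof -
      define F where "F = (\<lambda>x. \<Sum>b\<in>B. c b * D b x)"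
      have "derivation F"
        unfolding F_def by (rule derivation_linear_combination) (rule D)
      moreover have "F x = 0" if "x \<in> S" for x
      proof -
        obtain v k where "x = p v $ k" using \<open>x \<in> S\<close> unfolding S_def by blast
        then have "F x = (\<Sum>b\<in>B. c b *\<^sub>R vec (D b)) $ v $ k"
          by (simp add: F_def vec_def sum_component)
        then show ?thesis using \<open>(\<Sum>b\<in>B. c b *\<^sub>R vec (D b)) = 0\<close> by simp
      qed
      ultimately have "F b = 0"
        using derivation_vanishes_on_generated_subfield[of F S b] B(1) \<open>b \<in> B\<close> by blast
      then show ?thesis
        using \<open>b \<in> B\<close> B(2) by (simp add: F_def D_dual if_distrib cong: if_cong)
    qed
    have inj: "inj_on (\<lambda>b. vec (D b)) B"
    proof (rule inj_onI, rule ccontr)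
      fix b b' assume bb: "b \<in> B" "b' \<in> B" "vec (D b) = vec (D b')" "b \<noteq> b'"
      \<comment> \<open>Two equal vectors would satisfy a relation with coefficients 1 and
        -1.\<close>
      define c where "c x = (if x = b then 1 else if x = b' then - 1 else 0 :: real)" for x
      have "(\<Sum>x\<in>B. c x *\<^sub>R vec (D x)) = (\<Sum>x\<in>{b, b'}. c x *\<^sub>R vec (D x))"
        by (rule sum.mono_neutral_right) (use bb B(2) in \<open>auto simp: c_def\<close>)
      also have "\<dots> = 0"
        using bb by (simp add: c_def)
      finally show False
        using lin_indep[of c b] bb by (simp add: c_def)
    qed
    have "independent ((\<lambda>b. vec (D b)) ` B)"
    proof (rule independent_if_scalars_zero)
      show "finite ((\<lambda>b. vec (D b)) ` B)" using B(2) by simp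
      fix f x assume f: "(\<Sum>x\<in>(\<lambda>b. vec (D b)) ` B. f x *\<^sub>R x) = 0" "x \<in> (\<lambda>b. vec (D b)) ` B"
      then obtain b where "b \<in> B" "x = vec (D b)" by blast
      then show "f x = 0"
        using lin_indep[of "\<lambda>b. f (vec (D b))" b] f(1) inj by (simp add: sum.reindex)
    qed
    moreover have "(\<lambda>b. vec (D b)) ` B \<subseteq> W"
      using D unfolding W_def by blast
    ultimately have "card ((\<lambda>b. vec (D b)) ` B) \<le> dim W"
      by (rule independent_card_le_dim[rotated])
    then show ?thesis
      using B(4) inj by (simp add: card_image)
  qed
  ultimately have "W = range tangent"
    using subspace_dim_equal[OF sub_W sub_tangent] dim_tangent by linarith
  then have "tangent (\<chi> v. w v, \<chi> v. t v) \<in> W" by blast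
  then obtain D where "derivation D" "tangent (\<chi> v. w v, \<chi> v. t v) = vec D"
    unfolding W_def by blast
  then show ?thesis
    by (intro exI[of _ D]) (simp add: tangent_def vec_def vec_eq_iff forall_3)
qed

section \<open>Angles, heights and edge weights of a generic framework\<close>

definition cross_xy :: "('v \<Rightarrow> real ^ 3) \<Rightarrow> 'v \<Rightarrow> 'v \<Rightarrow> real" where
  "cross_xy p u v = p v $ 1 * p u $ 2 - p u $ 1 * p v $ 2"

text \<open>On the cylinder \<open>cross_xy p u v\<close> is the sine of the angle of
  \<open>u\<close> minus the angle of \<open>v\<close>, so this is the \<open>a u v\<close> of the
  introduction.\<close>

definition edge_weight :: "('v \<Rightarrow> real ^ 3) \<Rightarrow> 'v \<Rightarrow> 'v \<Rightarrow> real" where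
  "edge_weight p u v = (p u $ 3 - p v $ 3)\<^sup>2 / cross_xy p u v"

lemma cross_xy_commute: "cross_xy p v u = - cross_xy p u v"
  by (simp add: cross_xy_def)

lemma edge_weight_commute: "edge_weight p v u = - edge_weight p u v"
  by (simp add: edge_weight_def cross_xy_commute[of p v u] power2_commute)

context
  fixes p :: "'v::finite \<Rightarrow> real ^ 3"
  assumes cyl: "\<forall>v. p v \<in> unit_cylinder" and gen: "generic p"
begin

text \<open>Some derivation takes the value 1 at the height, whereas every derivation vanishes at
  0.\<close>

lemma generic_height_nonzero: "p v $ 3 \<noteq> 0"
proof
  assume "p v $ 3 = 0"
  moreover obtain D where "derivation D" "D (p v $ 3) = 1"
    using generic_tangent_derivation[OF cyl gen, of "\<lambda>_. 0" "\<lambda>_. 1"] by blast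
  ultimately show False
    using derivation_zero[of D] by simp
qed

lemma generic_rotation_derivation:
  "\<exists>D. derivation D \<and> D (p u $ 1) = - (p u $ 2) \<and> D (p u $ 2) = p u $ 1 \<and>
    (\<forall>v. v \<noteq> u \<longrightarrow> D (p v $ 1) = 0 \<and> D (p v $ 2) = 0)"
proof -
  obtain D where D: "derivation D"
    "\<And>v. D (p v $ 1) = - (p v $ 2) * (if v = u then 1 else 0)"
    "\<And>v. D (p v $ 2) = p v $ 1 * (if v = u then 1 else 0)"
    using generic_tangent_derivation[OF cyl gen, of "\<lambda>v. if v = u then 1 else 0" "\<lambda>_. 0"] by blast
  then show ?thesis by (intro exI[of _ D]) simp
qed

text \<open>The two quantities are the sine and the cosine of one angle difference; Lagrange's
  identity makes their squares sum to 1.\<close>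

lemma cross_dot_not_both_zero:
  assumes "cross_xy p u v = 0" "p u $ 1 * p v $ 1 + p u $ 2 * p v $ 2 = 0"
  shows False
proof -
  have "(cross_xy p u v)\<^sup>2 + (p u $ 1 * p v $ 1 + p u $ 2 * p v $ 2)\<^sup>2 =
      ((p u $ 1)\<^sup>2 + (p u $ 2)\<^sup>2) * ((p v $ 1)\<^sup>2 + (p v $ 2)\<^sup>2)"
    by (simp add: cross_xy_def power2_eq_square algebra_simps)
  also have "\<dots> = 1" using cyl by (simp add: unit_cylinder_def)
  finally show False using assms by simp
qed

text \<open>Rotating \<open>u\<close> alone differentiates the sine into the cosine, so a vanishing
  sine would force a vanishing cosine.\<close>

lemma generic_cross_nonzero:
  assumes "u \<noteq> v"
  shows "cross_xy p u v \<noteq> 0"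
proof
  assume zero: "cross_xy p u v = 0"
  obtain D where D: "derivation D" "D (p u $ 1) = - (p u $ 2)" "D (p u $ 2) = p u $ 1"
    "D (p v $ 1) = 0" "D (p v $ 2) = 0"
    using generic_rotation_derivation[of u] assms by metis
  have "D (cross_xy p u v) = p u $ 1 * p v $ 1 + p u $ 2 * p v $ 2"
    by (simp add: cross_xy_def derivation_diff[OF D(1)] derivation_mult[OF D(1)] D algebra_simps)
  then have "p u $ 1 * p v $ 1 + p u $ 2 * p v $ 2 = 0"
    using zero derivation_zero[OF D(1)] by simp
  then show False using cross_dot_not_both_zero zero by blast
qed

text \<open>Rotating \<open>v\<close> alone leaves the second term constant. Differentiating the
  relation twice in this direction makes first the cosine and then the sine of the angle between
  \<open>u\<close> and \<open>v\<close> vanish.\<close>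

lemma generic_cross_sum_nonzero:
  assumes "u \<noteq> v" "v \<noteq> w"
  shows "cross_xy p u v + cross_xy p w u \<noteq> 0"
proof
  assume zero: "cross_xy p u v + cross_xy p w u = 0"
  obtain D where D: "derivation D" "D (p v $ 1) = - (p v $ 2)" "D (p v $ 2) = p v $ 1"
    "D (p u $ 1) = 0" "D (p u $ 2) = 0" "D (p w $ 1) = 0" "D (p w $ 2) = 0"
    using generic_rotation_derivation[of v] assms by metis
  note rules = derivation_add[OF D(1)] derivation_diff[OF D(1)] derivation_mult[OF D(1)]
    derivation_minus[OF D(1)] derivation_zero[OF D(1)]
  define dot where "dot = p u $ 1 * p v $ 1 + p u $ 2 * p v $ 2"
  have "D (cross_xy p u v + cross_xy p w u) = - dot"
    by (simp add: cross_xy_def dot_def rules D algebra_simps)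
  then have "dot = 0" using zero rules(5) by simp
  moreover have "D dot = cross_xy p u v"
    by (simp add: cross_xy_def dot_def rules D algebra_simps)
  ultimately have "cross_xy p u v = 0" using rules(5) by simp
  then show False
    using cross_dot_not_both_zero \<open>dot = 0\<close> unfolding dot_def by blast
qed

text \<open>
  As a polynomial in the height of one vertex of the cycle, the sum has leading coefficient
  \<open>1 / cross_xy p u v + 1 / cross_xy p w u\<close>, where \<open>v\<close> and \<open>w\<close> are the neighbours of \<open>u\<close>.
\<close>

lemma generic_cycle_weight_nonzero:
  assumes xs: "distinct xs" "length xs \<ge> 3"
  shows "(\<Sum>i<length xs. edge_weight p (xs ! i) (xs ! (Suc i mod length xs))) \<noteq> 0"
proof
  assume zero: "(\<Sum>i<length xs. edge_weight p (xs ! i) (xs ! (Suc i mod length xs))) = 0"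
  obtain m where m: "length xs = Suc (Suc m)" "m > 0"
    using xs(2) by (metis Suc_le_D Suc_le_lessD numeral_3_eq_3 Suc_le_mono)
  define u v w where "u = xs ! 0" and "v = xs ! 1" and "w = xs ! Suc m"
  have ne: "u \<noteq> v" "v \<noteq> w" "u \<noteq> w"
    using xs(1) m by (simp_all add: u_def v_def w_def nth_eq_iff_index_eq)
  \<comment> \<open>The edges of the cycle that avoid \<open>u\<close>; the other two join
    \<open>u\<close> to its neighbours \<open>v\<close> and \<open>w\<close>.\<close>
  define rest where "rest = (\<Sum>i<m. edge_weight p (xs ! Suc i) (xs ! Suc (Suc i)))"
  have total: "edge_weight p u v + rest + edge_weight p w u = 0"
    using zero m sum.lessThan_Suc_shift[of "\<lambda>i. edge_weight p (xs ! i) (xs ! Suc i)" m]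
    by (simp add: u_def v_def w_def rest_def)
  \<comment> \<open>Differentiation with respect to the height of \<open>u\<close>, all other
    coordinates being constant.\<close>
  obtain D where D: "derivation D" "\<And>x. D (p x $ 1) = 0" "\<And>x. D (p x $ 2) = 0"
    "D (p u $ 3) = 1" "\<And>x. x \<noteq> u \<Longrightarrow> D (p x $ 3) = 0"
    using generic_tangent_derivation[OF cyl gen, of "\<lambda>_. 0" "\<lambda>x. if x = u then 1 else 0"] by auto
  note rules = derivation_add[OF D(1)] derivation_diff[OF D(1)] derivation_mult[OF D(1)]
    derivation_divide[OF D(1)] derivation_power2[OF D(1)] derivation_zero[OF D(1)]
    derivation_one[OF D(1)] derivation_minus[OF D(1)]
  have D2: "D 2 = 0"
    using rules(1)[of 1 1] rules(7) by simp
  have D_cross: "D (cross_xy p x y) = 0" for x y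
    by (simp add: cross_xy_def rules D)
  have D_weight: "D (edge_weight p x y) =
      2 * (p x $ 3 - p y $ 3) * (D (p x $ 3) - D (p y $ 3)) / cross_xy p x y" for x y
    by (simp add: edge_weight_def rules D_cross)
  have "xs ! Suc i \<noteq> u \<and> xs ! Suc (Suc i) \<noteq> u" if "i < m" for i
    using that xs(1) m by (simp add: u_def nth_eq_iff_index_eq)
  then have "D rest = 0"
    by (simp add: rest_def derivation_sum[OF D(1)] D_weight D)
  moreover have "D (edge_weight p u v + rest + edge_weight p w u) = 0"
    using total rules(6) by simp
  ultimately have "2 * (p u $ 3 - p v $ 3) / cross_xy p u v +
      2 * (p u $ 3 - p w $ 3) / cross_xy p w u = 0"
    (is "?h = 0") using ne by (simp add: rules D_weight D)
  \<comment> \<open>The sum is quadratic in the height of \<open>u\<close>, so a second derivative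
    isolates twice its leading coefficient.\<close>
  moreover have "D ?h = 2 / cross_xy p u v + 2 / cross_xy p w u"
    using ne by (simp add: rules D_cross D D2)
  ultimately have "2 / cross_xy p u v + 2 / cross_xy p w u = 0"
    using rules(6) by simp
  then have "cross_xy p u v + cross_xy p w u = 0"
    using generic_cross_nonzero[of u v] generic_cross_nonzero[of w u] ne
    by (simp add: divide_simps split: if_splits)
  then show False using generic_cross_sum_nonzero[of u v w] ne by blast
qed

end

section \<open>The kernel of the rigidity matrix\<close>

text \<open>
  The sign of the vertical speed makes the edge condition \<open>w u - w v = c * edge_weight p u v\<close>.
\<close>

definition motion :: "('v::finite \<Rightarrow> real ^ 3) \<Rightarrow> ('v \<Rightarrow> real) \<Rightarrow> real \<Rightarrow> real ^ 3 ^ 'v" where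
  "motion p w c = (\<chi> v. vector [- (p v $ 2) * w v, p v $ 1 * w v, - c * p v $ 3])"

lemma edge_row_motion:
  "(p u - p v) \<bullet> (motion p w c $ u - motion p w c $ v) =
     cross_xy p u v * (w u - w v) - c * (p u $ 3 - p v $ 3)\<^sup>2"
  by (simp add: motion_def cross_xy_def inner_vec_def sum_3 power2_eq_square algebra_simps)

definition vr_kernel :: "'v::finite \<Rightarrow> 'v set set \<Rightarrow> ('v \<Rightarrow> real ^ 3) \<Rightarrow> (real ^ 3 ^ 'v) set" where
  "vr_kernel v1 E p = {q. \<forall>r\<in>vr_matrix_rows v1 E p. r \<bullet> q = 0}"

lemma vr_kernel_iff:
  "q \<in> vr_kernel v1 E p \<longleftrightarrow>
     (\<forall>u v. {u, v} \<in> E \<longrightarrow> (p u - p v) \<bullet> (q $ u - q $ v) = 0) \<and>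
     (\<forall>v. v \<noteq> v1 \<longrightarrow> p v1 $ 3 * q $ v $ 3 = p v $ 3 * q $ v1 $ 3) \<and>
     (\<forall>v. p v $ 1 * q $ v $ 1 + p v $ 2 * q $ v $ 2 = 0)"
proof -
  have edge: "(axis u (p u - p v) + axis v (p v - p u)) \<bullet> q = (p u - p v) \<bullet> (q $ u - q $ v)" for u v
    by (simp add: inner_add_left inner_axis' inner_diff_left inner_diff_right)
  have height: "(axis v1 (vector [0, 0, - (p v $ 3)]) + axis v (vector [0, 0, p v1 $ 3])) \<bullet> q = 0 \<longleftrightarrow>
      p v1 $ 3 * q $ v $ 3 = p v $ 3 * q $ v1 $ 3" for v
    by (auto simp: inner_add_left inner_axis' inner_vec_def[where 'b = 3] sum_3)
  have normal: "axis v (vector [p v $ 1, p v $ 2, 0]) \<bullet> q = p v $ 1 * q $ v $ 1 + p v $ 2 * q $ v $ 2" for v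
    by (simp add: inner_axis' inner_vec_def[where 'b = 3] sum_3)
  have "q \<in> vr_kernel v1 E p \<longleftrightarrow>
     (\<forall>u v. {u, v} \<in> E \<longrightarrow> (axis u (p u - p v) + axis v (p v - p u)) \<bullet> q = 0) \<and>
     (\<forall>v. v \<noteq> v1 \<longrightarrow>
       (axis v1 (vector [0, 0, - (p v $ 3)]) + axis v (vector [0, 0, p v1 $ 3])) \<bullet> q = 0) \<and>
     (\<forall>v. axis v (vector [p v $ 1, p v $ 2, 0]) \<bullet> q = 0)"
    unfolding vr_kernel_def vr_matrix_rows_def ball_Un mem_Collect_eq conj_assoc
    by (intro arg_cong2[where f = "(\<and>)"]; blast)
  then show ?thesis unfolding edge height normal .
qed

text \<open>The normal rows force each horizontal velocity to be a rotation. The height rows make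
  the vertical speeds proportional to the heights, with the factor read off at \<open>v1\<close>.
  Dividing an edge row by the nonzero \<open>cross_xy\<close> gives the condition on
  \<open>w\<close>.\<close>

lemma vr_kernel_eq_motions:
  assumes cyl: "\<forall>v. p v \<in> unit_cylinder" and z1: "p v1 $ 3 \<noteq> 0"
    and cross: "\<forall>u v. {u, v} \<in> E \<longrightarrow> cross_xy p u v \<noteq> 0"
  shows "vr_kernel v1 E p =
    {motion p w c | w c. \<forall>u v. {u, v} \<in> E \<longrightarrow> w u - w v = c * edge_weight p u v}"
proof -
  have edge: "(p u - p v) \<bullet> (motion p w c $ u - motion p w c $ v) = 0 \<longleftrightarrow>
      w u - w v = c * edge_weight p u v" if "{u, v} \<in> E" for u v w c
    using cross that unfolding edge_row_motion edge_weight_def by (simp add: field_simps)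
  have circle: "(p v $ 1)\<^sup>2 + (p v $ 2)\<^sup>2 = 1" for v
    using cyl by (simp add: unit_cylinder_def)
  have motion_in: "motion p w c \<in> vr_kernel v1 E p \<longleftrightarrow>
      (\<forall>u v. {u, v} \<in> E \<longrightarrow> w u - w v = c * edge_weight p u v)" for w c
    unfolding vr_kernel_iff using edge by (auto simp: motion_def)
  have "\<exists>w c. q = motion p w c" if q: "q \<in> vr_kernel v1 E p" for q
  proof -
    define w where "w v = p v $ 1 * q $ v $ 2 - p v $ 2 * q $ v $ 1" for v
    define c where "c = - q $ v1 $ 3 / p v1 $ 3"
    have tan: "p v $ 1 * q $ v $ 1 + p v $ 2 * q $ v $ 2 = 0" for v
      using q unfolding vr_kernel_iff by blast
    have "- (p v $ 2) * w v = ((p v $ 1)\<^sup>2 + (p v $ 2)\<^sup>2) * q $ v $ 1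
          - p v $ 1 * (p v $ 1 * q $ v $ 1 + p v $ 2 * q $ v $ 2)" for v
      by (simp add: w_def algebra_simps power2_eq_square)
    then have 1: "- (p v $ 2) * w v = q $ v $ 1" for v by (simp add: tan circle)
    have "p v $ 1 * w v = ((p v $ 1)\<^sup>2 + (p v $ 2)\<^sup>2) * q $ v $ 2
          - p v $ 2 * (p v $ 1 * q $ v $ 1 + p v $ 2 * q $ v $ 2)" for v
      by (simp add: w_def algebra_simps power2_eq_square)
    then have 2: "p v $ 1 * w v = q $ v $ 2" for v by (simp add: tan circle)
    \<comment> \<open>The matrix has no height row for \<open>v1\<close>, where the equation is
      trivial.\<close>
    have "p v1 $ 3 * q $ v $ 3 = p v $ 3 * q $ v1 $ 3" for v
      using q unfolding vr_kernel_iff by (cases "v = v1") auto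
    then have 3: "- c * p v $ 3 = q $ v $ 3" for v
      using z1 by (simp add: c_def field_simps)
    have "q = motion p w c"
      using 1 2 3 by (simp add: motion_def vec_eq_iff forall_3)
    then show ?thesis by blast
  qed
  then show ?thesis using motion_in by blast
qed

text \<open>The motion determines \<open>w\<close> because each (x, y) is a unit vector, and
  \<open>c\<close> because \<open>v1\<close> has nonzero height.\<close>

lemma motion_in_span_rotation:
  assumes cyl: "\<forall>v. p v \<in> unit_cylinder" and z1: "p v1 $ 3 \<noteq> 0"
  shows "motion p w c \<in> span {motion p (\<lambda>_. 1) 0} \<longleftrightarrow> c = 0 \<and> (\<forall>u v. w u = w v)"
proof
  assume "motion p w c \<in> span {motion p (\<lambda>_. 1) 0}"
  then obtain k where k: "motion p w c = k *\<^sub>R motion p (\<lambda>_. 1) 0"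
    by (auto simp: span_singleton)
  have comp: "p v $ 2 * w v = k * p v $ 2" "p v $ 1 * w v = k * p v $ 1" "c * p v $ 3 = 0" for v
    using arg_cong[OF k, of "\<lambda>q. q $ v"] by (simp_all add: motion_def vec_eq_iff forall_3)
  have "w v = k" for v
  proof -
    have "w v = ((p v $ 1)\<^sup>2 + (p v $ 2)\<^sup>2) * w v"
      using cyl by (simp add: unit_cylinder_def)
    also have "\<dots> = p v $ 1 * (p v $ 1 * w v) + p v $ 2 * (p v $ 2 * w v)"
      by (simp add: power2_eq_square algebra_simps)
    also have "\<dots> = k * ((p v $ 1)\<^sup>2 + (p v $ 2)\<^sup>2)"
      unfolding comp by (simp add: power2_eq_square algebra_simps)
    also have "\<dots> = k"
      using cyl by (simp add: unit_cylinder_def)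
    finally show ?thesis .
  qed
  then show "c = 0 \<and> (\<forall>u v. w u = w v)"
    using comp(3)[of v1] z1 by simp
next
  assume *: "c = 0 \<and> (\<forall>u v. w u = w v)"
  then have "w v = w v1" for v by blast
  then have "motion p w c = w v1 *\<^sub>R motion p (\<lambda>_. 1) 0"
    using * by (simp add: motion_def vec_eq_iff forall_3)
  then show "motion p w c \<in> span {motion p (\<lambda>_. 1) 0}"
    by (auto simp: span_singleton)
qed

text \<open>The kernel is the orthogonal complement of the row space, so the two dimensions add up
  to \<open>3 * CARD('v)\<close>.\<close>

lemma vr_rigid_iff_dim_kernel: "vr_rigid v1 E p \<longleftrightarrow> dim (vr_kernel v1 E p) = 1"
  for p :: "'v::finite \<Rightarrow> real ^ 3"
proof -
  let ?R = "vr_matrix_rows v1 E p"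
  have "(\<forall>x\<in>span ?R. orthogonal x q) \<longleftrightarrow> (\<forall>r\<in>?R. r \<bullet> q = 0)" for q
    using orthogonal_to_span[of _ ?R q] span_base[of _ ?R]
    by (auto simp: orthogonal_def inner_commute)
  then have "{q \<in> UNIV. \<forall>x\<in>span ?R. orthogonal x q} = vr_kernel v1 E p"
    unfolding vr_kernel_def by simp
  then have "dim (vr_kernel v1 E p) + dim ?R = 3 * CARD('v)"
    using dim_subspace_orthogonal_to_vectors[of "span ?R" UNIV] by (simp add: mult.commute)
  \<comment> \<open>This keeps the natural-number subtraction in \<open>3 * CARD('v) - 1\<close>
    from truncating.\<close>
  moreover have "CARD('v) > 0" by simp
  ultimately show ?thesis
    unfolding vr_rigid_def vr_matrix_rank_def by linarith
qed

text \<open>The common rotation \<open>?r\<close> is nonzero and always in the kernel, so the kernel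
  has dimension 1 exactly when it lies in the span of \<open>?r\<close>.\<close>

lemma vr_rigid_iff_potentials:
  fixes p :: "'v::finite \<Rightarrow> real ^ 3"
  assumes cyl: "\<forall>v. p v \<in> unit_cylinder" and z1: "p v1 $ 3 \<noteq> 0"
    and cross: "\<forall>u v. {u, v} \<in> E \<longrightarrow> cross_xy p u v \<noteq> 0"
  shows "vr_rigid v1 E p \<longleftrightarrow>
    (\<forall>w c. (\<forall>u v. {u, v} \<in> E \<longrightarrow> w u - w v = c * edge_weight p u v) \<longrightarrow>
       c = 0 \<and> (\<forall>u v. w u = w v))"
proof -
  let ?K = "vr_kernel v1 E p" and ?r = "motion p (\<lambda>_. 1) 0"
  have "?r \<noteq> 0"
  proof
    assume "?r = 0"
    then have "p v1 $ 1 = 0 \<and> p v1 $ 2 = 0" by (simp add: motion_def vec_eq_iff forall_3)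
    moreover have "(p v1 $ 1)\<^sup>2 + (p v1 $ 2)\<^sup>2 = 1" using cyl by (simp add: unit_cylinder_def)
    ultimately show False by simp
  qed
  then have dim_r: "dim (span {?r}) = 1"
    by (simp add: dim_eq_card_independent)
  note K = vr_kernel_eq_motions[of p v1 E, OF cyl z1 cross]
  have r: "?r \<in> ?K"
    unfolding vr_kernel_iff edge_row_motion by (simp add: motion_def)
  have sub: "subspace ?K"
    unfolding vr_kernel_def by (auto simp: subspace_def inner_add_right)
  have "dim ?K = 1 \<longleftrightarrow> ?K \<subseteq> span {?r}"
  proof
    assume "dim ?K = 1"
    moreover have "span {?r} \<subseteq> ?K"
      using r sub by (simp add: span_minimal)
    ultimately show "?K \<subseteq> span {?r}"
      using subspace_dim_equal[OF subspace_span sub, of "{?r}"] dim_r by simp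
  next
    assume "?K \<subseteq> span {?r}"
    moreover have "span {?r} \<subseteq> ?K"
      using r sub by (simp add: span_minimal)
    ultimately show "dim ?K = 1" using dim_r by simp
  qed
  also have "\<dots> \<longleftrightarrow> (\<forall>w c. (\<forall>u v. {u, v} \<in> E \<longrightarrow> w u - w v = c * edge_weight p u v) \<longrightarrow>
      motion p w c \<in> span {?r})"
    unfolding K by auto
  finally show ?thesis
    unfolding vr_rigid_iff_dim_kernel motion_in_span_rotation[OF cyl z1] .
qed

section \<open>Potentials and cycles\<close>

text \<open>This puts connectedness in the form of the potential condition with
  \<open>c = 0\<close>. The converse tests the indicator function of the vertices reachable from
  \<open>u\<close>.\<close>

lemma connected_graph_iff_constant:
  "connected_graph E \<longleftrightarrow>
     (\<forall>f :: 'v \<Rightarrow> real. (\<forall>u v. {u, v} \<in> E \<longrightarrow> f u = f v) \<longrightarrow> (\<forall>u v. f u = f v))"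
proof (intro iffI allI impI)
  fix f :: "'v \<Rightarrow> real" and u v
  assume "connected_graph E" and f: "\<forall>u v. {u, v} \<in> E \<longrightarrow> f u = f v"
  then have "(u, v) \<in> {(a, b). {a, b} \<in> E}\<^sup>*" by (simp add: connected_graph_def)
  then show "f u = f v" by (induction rule: rtrancl_induct) (use f in auto)
next
  let ?R = "{(a, b). {a, b} \<in> E}"
  assume *: "\<forall>f :: 'v \<Rightarrow> real. (\<forall>u v. {u, v} \<in> E \<longrightarrow> f u = f v) \<longrightarrow> (\<forall>u v. f u = f v)"
  have "(u, v) \<in> ?R\<^sup>*" for u v
  proof -
    define f :: "'v \<Rightarrow> real" where "f x = (if (u, x) \<in> ?R\<^sup>* then 1 else 0)" for x
    have "f x = f y" if "{x, y} \<in> E" for x y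
    proof -
      have "(x, y) \<in> ?R" "(y, x) \<in> ?R" using that by (simp_all add: insert_commute)
      then have "(u, x) \<in> ?R\<^sup>* \<longleftrightarrow> (u, y) \<in> ?R\<^sup>*" by (meson rtrancl.rtrancl_into_rtrancl)
      then show ?thesis by (simp add: f_def)
    qed
    then have "f u = f v" using * by blast
    then show ?thesis by (simp add: f_def split: if_splits)
  qed
  then show "connected_graph E" by (simp add: connected_graph_def)
qed

section \<open>Cycles, paths and forests\<close>

lemma cyclic_telescope:
  fixes f :: "'a \<Rightarrow> real"
  assumes "xs \<noteq> []"
  shows "(\<Sum>i<length xs. f (xs ! i) - f (xs ! (Suc i mod length xs))) = 0"
proof -
  obtain m where m: "length xs = Suc m"
    using assms by (cases xs) auto
  have "(\<Sum>i<m. f (xs ! i) - f (xs ! (Suc i mod Suc m))) = (\<Sum>i<m. f (xs ! i) - f (xs ! Suc i))"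
    by (rule sum.cong) auto
  also have "\<dots> = f (xs ! 0) - f (xs ! m)"
    by (rule sum_lessThan_telescope')
  finally show ?thesis by (simp add: m)
qed

text \<open>Two positions with the same edge would each be the cyclic successor of the other, which
  is impossible for length at least 3.\<close>

lemma cycle_edge_inject:
  assumes "distinct xs" "length xs \<ge> 3" "i < length xs" "j < length xs"
    and "{xs ! i, xs ! (Suc i mod length xs)} = {xs ! j, xs ! (Suc j mod length xs)}"
  shows "i = j"
proof (rule ccontr)
  assume "i \<noteq> j"
  have "length xs > 0" using assms(3) by linarith
  then have "Suc i mod length xs < length xs" "Suc j mod length xs < length xs"
    by simp_all
  then have "i = Suc j mod length xs" "Suc i mod length xs = j"
    using assms \<open>i \<noteq> j\<close> by (auto simp: doubleton_eq_iff nth_eq_iff_index_eq)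
  then show False
    using assms(2-4) by (auto simp: mod_Suc split: if_splits)
qed

text \<open>The differences of a function around the cycle sum to 0. If all but the one along
  \<open>e\<close> vanish, that one vanishes too.\<close>

lemma connected_graph_remove_cycle_edge:
  fixes E :: "'v set set"
  assumes E: "connected_graph E" and C: "is_cycle C" "C \<subseteq> E" and e: "e \<in> C"
  shows "connected_graph (E - {e})"
  unfolding connected_graph_iff_constant
proof (intro allI impI)
  fix f :: "'v \<Rightarrow> real" and a b
  assume f: "\<forall>u v. {u, v} \<in> E - {e} \<longrightarrow> f u = f v"
  obtain xs where xs: "distinct xs" "length xs \<ge> 3"
    and C_eq: "C = {{xs ! i, xs ! (Suc i mod length xs)} | i. i < length xs}"
    using C(1) unfolding is_cycle_def by blast
  obtain k where k: "k < length xs" "e = {xs ! k, xs ! (Suc k mod length xs)}"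
    using e C_eq by blast
  let ?d = "\<lambda>i. f (xs ! i) - f (xs ! (Suc i mod length xs))"
  have "?d i = 0" if "i < length xs" "i \<noteq> k" for i
  proof -
    have "{xs ! i, xs ! (Suc i mod length xs)} \<noteq> e"
      using cycle_edge_inject[OF xs that(1) k(1)] that(2) k(2) by blast
    then have "{xs ! i, xs ! (Suc i mod length xs)} \<in> E - {e}"
      using C(2) C_eq that(1) by blast
    then show ?thesis using f by simp
  qed
  then have "(\<Sum>i<length xs. ?d i) = (\<Sum>i\<in>{k}. ?d i)"
    using k(1) by (intro sum.mono_neutral_right) auto
  moreover have "xs \<noteq> []" using xs(2) by auto
  ultimately have "?d k = 0" using cyclic_telescope[of xs f] by simp
  then have "f u = f v" if "{u, v} = e" for u v
    using that k(2) by (auto simp: doubleton_eq_iff)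
  then have "\<forall>u v. {u, v} \<in> E \<longrightarrow> f u = f v" using f by blast
  then show "f a = f b" using E unfolding connected_graph_iff_constant by blast
qed

text \<open>When the walk steps to a vertex already on the path, the path is cut back to that
  vertex; otherwise the vertex is appended.\<close>

lemma distinct_path_exists:
  assumes "(x, y) \<in> {(a, b). {a, b} \<in> F}\<^sup>*"
  shows "\<exists>xs. distinct xs \<and> xs \<noteq> [] \<and> xs ! 0 = x \<and> xs ! (length xs - 1) = y \<and>
    (\<forall>i. Suc i < length xs \<longrightarrow> {xs ! i, xs ! Suc i} \<in> F)"
  using assms
proof (induction rule: rtrancl_induct)
  case base
  show ?case by (rule exI[of _ "[x]"]) simp
next
  case (step y z)
  then obtain xs where xs: "distinct xs" "xs \<noteq> []" "xs ! 0 = x" "xs ! (length xs - 1) = y"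
    "\<And>i. Suc i < length xs \<Longrightarrow> {xs ! i, xs ! Suc i} \<in> F" by blast
  show ?case
  proof (cases "z \<in> set xs")
    case True
    then obtain j where "j < length xs" "xs ! j = z" by (auto simp: in_set_conv_nth)
    moreover from this have "length (take (Suc j) xs) = Suc j" by simp
    ultimately show ?thesis
      using xs by (intro exI[of _ "take (Suc j) xs"]) (auto simp del: length_take)
  next
    case False
    have "{(xs @ [z]) ! i, (xs @ [z]) ! Suc i} \<in> F" if "Suc i < length (xs @ [z])" for i
    proof (cases "Suc i < length xs")
      case True
      then show ?thesis using xs(5)[OF True] by (simp add: nth_append)
    next
      case False
      then have "i = length xs - 1" "Suc i = length xs" using that by auto
      then show ?thesis using xs(4) step(2) by (simp add: nth_append)
    qed
    then show ?thesis
      using xs False by (intro exI[of _ "xs @ [z]"]) (auto simp: nth_append)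
  qed
qed

text \<open>The new edge closes a path from \<open>x\<close> to \<open>y\<close>. The path has at
  least three vertices: \<open>x \<noteq> y\<close> excludes one, and
  \<open>{x, y} \<notin> F\<close> excludes two.\<close>

lemma cycle_through_new_edge:
  assumes "(x, y) \<in> {(a, b). {a, b} \<in> F}\<^sup>*" "x \<noteq> y" "{x, y} \<notin> F"
  shows "\<exists>C \<subseteq> insert {x, y} F. is_cycle C \<and> {x, y} \<in> C"
proof -
  obtain xs where xs: "distinct xs" "xs \<noteq> []" "xs ! 0 = x" "xs ! (length xs - 1) = y"
    "\<And>i. Suc i < length xs \<Longrightarrow> {xs ! i, xs ! Suc i} \<in> F"
    using distinct_path_exists[OF assms(1)] by blast
  have "length xs \<noteq> 0" "length xs \<noteq> 1" using xs assms(2) by auto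
  moreover have "length xs \<noteq> 2"
    using xs(3,4) xs(5)[of 0] assms(3) by (auto simp: numeral_2_eq_2)
  ultimately have len: "length xs \<ge> 3" by linarith
  define C where "C = {{xs ! i, xs ! (Suc i mod length xs)} | i. i < length xs}"
  have "is_cycle C"
    unfolding is_cycle_def C_def using xs(1) len by blast
  moreover have "{xs ! i, xs ! (Suc i mod length xs)} \<in> insert {x, y} F" if "i < length xs" for i
  proof (cases "Suc i < length xs")
    case True
    then show ?thesis using xs(5) by simp
  next
    case False
    then have "Suc i = length xs" using that by simp
    then have "i = length xs - 1" "Suc i mod length xs = 0" by simp_all
    then show ?thesis using xs by (simp add: insert_commute)
  qed
  then have "C \<subseteq> insert {x, y} F" unfolding C_def by blast
  moreover have "{x, y} \<in> C"
  proof -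
    have "Suc (length xs - 1) = length xs" using len by simp
    then have "length xs - 1 < length xs" "Suc (length xs - 1) mod length xs = 0"
      by simp_all
    moreover from this have "{x, y} = {xs ! (length xs - 1), xs ! (Suc (length xs - 1) mod length xs)}"
      using xs by (simp add: insert_commute)
    ultimately show ?thesis unfolding C_def by blast
  qed
  ultimately show ?thesis by blast
qed

text \<open>Edges are added one at a time. Without cycles each new edge joins two different
  components, so shifting the potential on one of them meets the new condition and keeps the old
  ones.\<close>

lemma forest_potential:
  fixes a :: "'v \<Rightarrow> 'v \<Rightarrow> real"
  assumes "finite E" "simple_graph E" "\<And>C. C \<subseteq> E \<Longrightarrow> \<not> is_cycle C"
    and anti: "\<And>u v. a v u = - a u v"
  shows "\<exists>w. \<forall>u v. {u, v} \<in> E \<longrightarrow> w u - w v = a u v"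
  using assms(1-3)
proof (induction E rule: finite_induct)
  case (insert e F)
  let ?R = "{(a, b). {a, b} \<in> F}"
  have "simple_graph F" "\<And>C. C \<subseteq> F \<Longrightarrow> \<not> is_cycle C"
    using insert.prems by (auto simp: simple_graph_def)
  then obtain w where w: "\<And>u v. {u, v} \<in> F \<Longrightarrow> w u - w v = a u v"
    using insert.IH by blast
  obtain x y where e: "e = {x, y}" "x \<noteq> y"
    using insert.prems(1) by (auto simp: simple_graph_def card_2_iff)
  have sep: "(x, y) \<notin> ?R\<^sup>*"
    using cycle_through_new_edge[of x y F] e insert by blast
  \<comment> \<open>The shift applies to the component of \<open>x\<close>, which does not contain
    \<open>y\<close>, and is chosen so that \<open>w' x - w' y = a x y\<close>.\<close>
  define w' where "w' v = w v + (if (x, v) \<in> ?R\<^sup>* then a x y - (w x - w y) else 0)" for v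
  have "w' u - w' v = a u v" if "{u, v} \<in> insert e F" for u v
  proof (cases "{u, v} \<in> F")
    case True
    then have "(u, v) \<in> ?R" "(v, u) \<in> ?R" by (simp_all add: insert_commute)
    then have "(x, u) \<in> ?R\<^sup>* \<longleftrightarrow> (x, v) \<in> ?R\<^sup>*" by (meson rtrancl.rtrancl_into_rtrancl)
    then show ?thesis using w[OF True] by (simp add: w'_def)
  next
    case False
    have "w' x - w' y = a x y" using sep by (simp add: w'_def)
    moreover have "u = x \<and> v = y \<or> u = y \<and> v = x"
      using that False e(1) by (auto simp: doubleton_eq_iff)
    ultimately show ?thesis using anti[of x y] by auto
  qed
  then show ?case by blast
qed simp

text \<open>Potentials with \<open>c = 0\<close> detect connectedness. In a forest the weights have
  a potential, which is a motion with \<open>c = 1\<close>. Around a cycle the potential differences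
  sum to 0 but the generic weights do not, which forces \<open>c = 0\<close>.\<close>

lemma vr_rigid_iff_connected_with_cycle:
  fixes p :: "'v::finite \<Rightarrow> real ^ 3"
  assumes simple: "simple_graph E" and cyl: "\<forall>v. p v \<in> unit_cylinder" and gen: "generic p"
  shows "vr_rigid v1 E p \<longleftrightarrow> connected_graph E \<and> (\<exists>C \<subseteq> E. is_cycle C)"
proof -
  have "u \<noteq> v" if "{u, v} \<in> E" for u v
    using simple that by (auto simp: simple_graph_def)
  then have "\<forall>u v. {u, v} \<in> E \<longrightarrow> cross_xy p u v \<noteq> 0"
    using generic_cross_nonzero[OF cyl gen] by blast
  note rigid_iff = vr_rigid_iff_potentials[of p v1 E, OF cyl generic_height_nonzero[OF cyl gen] this]
  show ?thesis
  proof
    assume "vr_rigid v1 E p"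
    then have rigid: "c = 0 \<and> (\<forall>u v. w u = w v)"
      if "\<And>u v. {u, v} \<in> E \<Longrightarrow> w u - w v = c * edge_weight p u v" for w c
      using that unfolding rigid_iff by blast
    have "connected_graph E"
      unfolding connected_graph_iff_constant using rigid[of _ 0] by simp
    moreover have "\<exists>C \<subseteq> E. is_cycle C"
    proof (rule ccontr)
      assume "\<not> ?thesis"
      then have acyclic: "\<And>C. C \<subseteq> E \<Longrightarrow> \<not> is_cycle C" by blast
      have "\<exists>w. \<forall>u v. {u, v} \<in> E \<longrightarrow> w u - w v = edge_weight p u v"
        by (rule forest_potential[OF finite simple acyclic]) (assumption, rule edge_weight_commute)
      then obtain w where "\<And>u v. {u, v} \<in> E \<Longrightarrow> w u - w v = edge_weight p u v"
        by blast
      then show False using rigid[of w 1] by simp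
    qed
    ultimately show "connected_graph E \<and> (\<exists>C \<subseteq> E. is_cycle C)" ..
  next
    assume R: "connected_graph E \<and> (\<exists>C \<subseteq> E. is_cycle C)"
    then obtain C where C: "C \<subseteq> E" "is_cycle C" by blast
    then obtain xs where xs: "distinct xs" "length xs \<ge> 3"
      and C_eq: "C = {{xs ! i, xs ! (Suc i mod length xs)} | i. i < length xs}"
      unfolding is_cycle_def by blast
    have cyc: "{xs ! i, xs ! (Suc i mod length xs)} \<in> E" if "i < length xs" for i
      using that C(1) unfolding C_eq by blast
    have "c = 0 \<and> (\<forall>u v. w u = w v)"
      if w: "\<And>u v. {u, v} \<in> E \<Longrightarrow> w u - w v = c * edge_weight p u v" for w c
    proof -
      have "xs \<noteq> []" using xs(2) by auto
      then have "0 = (\<Sum>i<length xs. w (xs ! i) - w (xs ! (Suc i mod length xs)))"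
        by (simp add: cyclic_telescope)
      also have "\<dots> = c * (\<Sum>i<length xs. edge_weight p (xs ! i) (xs ! (Suc i mod length xs)))"
        unfolding sum_distrib_left by (rule sum.cong) (use w cyc in auto)
      finally have "c = 0"
        using generic_cycle_weight_nonzero[OF cyl gen xs] by simp
      then have "\<forall>u v. {u, v} \<in> E \<longrightarrow> w u = w v" using w by force
      then show ?thesis
        using R \<open>c = 0\<close> unfolding connected_graph_iff_constant by blast
    qed
    then show "vr_rigid v1 E p" unfolding rigid_iff by blast
  qed
qed

theorem theorem7p1:
  fixes E :: "'v::finite set set"
    and v1 :: 'v
    and p :: "'v \<Rightarrow> real ^ 3"
  assumes "simple_graph E"
    and "\<forall>v. p v \<in> unit_cylinder"
    and "generic p"
  shows "vr_minimally_rigid v1 E p \<longleftrightarrow> connected_graph E \<and> has_exactly_one_cycle E"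
proof -
  have "simple_graph (E - {e})" for e
    using assms(1) by (simp add: simple_graph_def)
  note rigid_iff = vr_rigid_iff_connected_with_cycle[OF assms]
    and rigid_del_iff = vr_rigid_iff_connected_with_cycle[OF this assms(2,3)]
  show ?thesis
  proof
    assume min: "vr_minimally_rigid v1 E p"
    then have conn: "connected_graph E" and ex: "\<exists>C \<subseteq> E. is_cycle C"
      unfolding vr_minimally_rigid_def rigid_iff by auto
    \<comment> \<open>If an edge of \<open>C\<close> were missing from \<open>C'\<close>, deleting
      it would leave a connected graph that still contains \<open>C'\<close>, hence a rigid
      one.\<close>
    have sub: "C \<subseteq> C'" if C: "C \<subseteq> E" "is_cycle C" and C': "C' \<subseteq> E" "is_cycle C'" for C C'
    proof
      fix e assume "e \<in> C"
      then have "connected_graph (E - {e})"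
        using connected_graph_remove_cycle_edge conn C by blast
      moreover have "\<not> vr_rigid v1 (E - {e}) p"
        using min \<open>e \<in> C\<close> C(1) unfolding vr_minimally_rigid_def by blast
      ultimately show "e \<in> C'"
        using C' unfolding rigid_del_iff by blast
    qed
    have "has_exactly_one_cycle E"
      unfolding has_exactly_one_cycle_def
    proof (rule ex_ex1I)
      show "C = C'" if "C \<subseteq> E \<and> is_cycle C" "C' \<subseteq> E \<and> is_cycle C'" for C C'
      proof (rule subset_antisym)
        show "C \<subseteq> C'" by (rule sub) (use that in auto)
        show "C' \<subseteq> C" by (rule sub) (use that in auto)
      qed
    qed (rule ex)
    then show "connected_graph E \<and> has_exactly_one_cycle E" using conn by simp
  next
    assume R: "connected_graph E \<and> has_exactly_one_cycle E"
    then have "\<exists>!C. C \<subseteq> E \<and> is_cycle C"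
      by (simp add: has_exactly_one_cycle_def)
    then obtain C where C: "C \<subseteq> E \<and> is_cycle C"
      and uniq: "\<forall>C'. C' \<subseteq> E \<and> is_cycle C' \<longrightarrow> C' = C"
      by (rule ex1E)
    \<comment> \<open>If the graph stayed rigid, it would keep a cycle \<open>C'\<close> avoiding
      \<open>e\<close>, and its connectedness would give a second cycle \<open>C''\<close> of
      \<open>E\<close> through \<open>e\<close>.\<close>
    have "\<not> vr_rigid v1 (E - {e}) p" if "e \<in> E" for e
    proof
      assume "vr_rigid v1 (E - {e}) p"
      then obtain C' where conn: "connected_graph (E - {e})" and C': "C' \<subseteq> E - {e}" "is_cycle C'"
        unfolding rigid_del_iff by blast
      have "card e = 2"
        using assms(1) \<open>e \<in> E\<close> by (simp add: simple_graph_def)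
      then obtain x y where e: "e = {x, y}" "x \<noteq> y"
        unfolding card_2_iff by blast
      have "(x, y) \<in> {(a, b). {a, b} \<in> E - {e}}\<^sup>*" "{x, y} \<notin> E - {e}"
        using conn e(1) by (simp_all add: connected_graph_def)
      from cycle_through_new_edge[OF this(1) e(2) this(2)]
      obtain C'' where "C'' \<subseteq> insert e (E - {e})" "is_cycle C''" "e \<in> C''"
        unfolding e(1) by blast
      then have "C'' = C"
        using \<open>e \<in> E\<close> by (intro uniq[rule_format]) auto
      moreover have "C' = C"
        using C' by (intro uniq[rule_format]) auto
      ultimately show False
        using \<open>e \<in> C''\<close> C'(1) by blast
    qed
    moreover have "vr_rigid v1 E p"
      using R C unfolding rigid_iff by blast
    ultimately show "vr_minimally_rigid v1 E p" unfolding vr_minimally_rigid_def by blast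
  qed
qed

end
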